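(* The set $\mathcal{M}_{\frac{\lambda}{2}}$ has zero asymptotic density.
   Context: $\lambda$ is the Carmichael function ($\lambda(n)$ is the exponent of the group of units of $\mathbb{Z}/n\mathbb{Z}$); $\lambda(n)/2$ is a positive integer for $n\ge 3$. For positive integers $n,k$, $S_k(n):=\sum_{j=1}^n j^k$. $\mathcal{M}_{\frac{\lambda}{2}}$ is the set of integers $n\ge 3$ such that $n$ divides $S_{\lambda(n)/2}(n)$. The asymptotic density of a set $A$ of positive integers is $\lim_{N\to\infty}\frac1N\mathrm{card}(A\cap[1,N])$. *)

theory Defs
  imports Complex_Main "HOL-Number_Theory.Number_Theory"
begin

definition power_sum :: "nat \<Rightarrow> nat \<Rightarrow> nat" where
  "power_sum k n = (\<Sum>j=1..n. j ^ k)"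

(* The division by 2 is exact for n >= 3, by the library's even_Carmichael. *)
definition M_half_Carmichael :: "nat set" where
  "M_half_Carmichael = {n. n \<ge> 3 \<and> n dvd power_sum (Carmichael n div 2) n}"

definition has_asymptotic_density :: "nat set \<Rightarrow> real \<Rightarrow> bool" where
  "has_asymptotic_density A d \<longleftrightarrow>
     (\<lambda>N. real (card (A \<inter> {1..N})) / real N) \<longlonglongrightarrow> d"

lemma half_Carmichael_pos:
  assumes "n \<ge> 3"
  shows "Carmichael n div 2 > 0"
proof -
  have "even (Carmichael n)" using assms by (intro even_Carmichael) auto
  thus ?thesis using Carmichael_pos[of n] by presburger
qed

end

theory Submission
  imports Defs "HOL-Analysis.Infinite_Sum" "HOL-Analysis.Summation_Tests"
begin

text \<open>
  A member of \<open>M_half_Carmichael\<close> cannot have prime factors in both odd residue classes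
  modulo \<open>4\<close>, and almost every integer does.

  For the first claim, let \<open>p\<close> be an odd prime factor of \<open>n\<close> with \<open>p - 1 dvd k\<close>, \<open>k > 0\<close>. Then \<open>n\<close>
  does not divide \<open>1 ^ k + ... + n ^ k\<close>: modulo \<open>p\<close>, Fermat's theorem turns each block of \<open>p\<close>
  consecutive summands into \<open>p - 1\<close>, and a descent along the powers of \<open>p\<close> reduces the general case to
  the one where \<open>p\<close> divides \<open>n\<close> once (\<open>not_dvd_power_sum\<close>). Now suppose that a prime \<open>p\<close> congruent
  to \<open>3\<close> and a prime \<open>q\<close> congruent to \<open>1\<close> modulo \<open>4\<close> divide \<open>n\<close>. The Carmichael number \<open>\<lambda>\<close> of \<open>n\<close> is
  a multiple of \<open>q - 1\<close>, hence of \<open>4\<close>, while \<open>p - 1\<close> is twice an odd number; so halving \<open>\<lambda>\<close> leaves it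
  a multiple of \<open>p - 1\<close>, and \<open>n\<close> is not in the set (\<open>M_half_Carmichael_residues\<close>).

  For the second claim, sieving by a finite set \<open>P\<close> of primes leaves a set of density
  \<open>\<Prod>p\<in>P. 1 - 1 / p\<close> (\<open>card_sieve\<close>), so it suffices that these products become arbitrarily small
  when \<open>P\<close> runs through primes of one fixed odd residue class modulo \<open>4\<close>
  (\<open>prod_primes_mod_4_small\<close>). This is the quantitative form of Dirichlet's theorem, and for the
  modulus \<open>4\<close> it can be had from real \<open>s > 1\<close> alone: by the Euler products, \<open>\<zeta>(s) / L(s, \<chi>)\<close> is, up
  to bounded factors, governed by the primes congruent to \<open>3\<close>, and \<open>\<zeta>(s) * L(s, \<chi>)\<close> by those
  congruent to \<open>1\<close>. Since \<open>L(s, \<chi>)\<close> stays between \<open>2 / 3\<close> and \<open>1\<close> and \<open>\<zeta>(s)\<close> is unbounded for \<open>s\<close>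
  near \<open>1\<close>, neither class can have products bounded away from \<open>0\<close>.
\<close>

section \<open>Divisibility of power sums\<close>

lemma power_add_mult_cong_square:
  fixes u m v :: nat
  shows "[(m * v + u) ^ k = u ^ k + k * u ^ (k - 1) * (m * v)] (mod m\<^sup>2)"
proof (induction k)
  case (Suc k)
  have "[(m * v + u) ^ Suc k = (m * v + u) * (u ^ k + k * u ^ (k - 1) * (m * v))] (mod m\<^sup>2)"
    using Suc by (simp add: cong_scalar_left)
  also have "(m * v + u) * (u ^ k + k * u ^ (k - 1) * (m * v)) =
      u ^ Suc k + Suc k * u ^ k * (m * v) + m\<^sup>2 * (k * u ^ (k - 1) * v\<^sup>2)"
    by (cases k) (simp_all add: algebra_simps power2_eq_square)
  also have "[\<dots> = u ^ Suc k + Suc k * u ^ k * (m * v)] (mod m\<^sup>2)"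
    unfolding cong_def by (rule mod_mult_self2)
  finally show ?case by simp
qed simp

text \<open>
  Writing \<open>j = m * v + u\<close> with \<open>u < m\<close> makes both uses below possible: for fixed \<open>u\<close> the summands
  can be expanded around \<open>u\<close>, and for \<open>m\<close> prime they are all congruent modulo \<open>m\<close>.
\<close>

lemma sum_powers_mult:
  "(\<Sum>j<p * m. j ^ k) = (\<Sum>u<m. \<Sum>v<p. (m * v + u) ^ k)" for p m k :: nat
proof -
  have "(\<Sum>j<p * m. j ^ k) = (\<Sum>v<p. \<Sum>j = v * m..<v * m + m. j ^ k)"
    by (rule sum.nat_group [symmetric])
  also have "\<dots> = (\<Sum>v<p. \<Sum>u<m. (m * v + u) ^ k)"
  proof (rule sum.cong)
    fix v
    show "(\<Sum>j = v * m..<v * m + m. j ^ k) = (\<Sum>u<m. (m * v + u) ^ k)"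
      using sum.shift_bounds_nat_ivl [of "\<lambda>j. j ^ k" 0 "v * m" m]
      by (simp add: lessThan_atLeast0 ac_simps)
  qed simp
  also have "\<dots> = (\<Sum>u<m. \<Sum>v<p. (m * v + u) ^ k)"
    by (rule sum.swap)
  finally show ?thesis .
qed

lemma odd_dvd_sum_lessThan:
  fixes p :: nat
  assumes "odd p"
  shows "p dvd (\<Sum>v<p. v)"
proof -
  have "2 * (\<Sum>v<p. v) = p * (p - 1)"
    by (induction p) (auto simp: algebra_simps)
  hence "p dvd 2 * (\<Sum>v<p. v)" by simp
  with assms show ?thesis
    by (simp add: coprime_dvd_mult_right_iff)
qed

text \<open>
  By the expansion to first order in \<open>m\<close>, the summands with fixed remainder \<open>u\<close> add up to
  \<open>p * u ^ k\<close> plus \<open>k * u ^ (k - 1) * m\<close> times \<open>0 + 1 + ... + (p - 1)\<close>. The last sum is a multiple of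
  \<open>p\<close> because \<open>p\<close> is odd, and the error modulo \<open>m\<^sup>2\<close> is harmless because \<open>p\<close> divides \<open>m\<close>. Hence the sum
  up to \<open>p * m\<close> is \<open>p\<close> times the sum up to \<open>m\<close>, modulo \<open>p * m\<close>.
\<close>

lemma sum_powers_descent:
  fixes p m k :: nat
  assumes "odd p" "p dvd m" "p * m dvd (\<Sum>j<p * m. j ^ k)"
  shows "m dvd (\<Sum>j<m. j ^ k)"
proof -
  from odd_dvd_sum_lessThan [OF \<open>odd p\<close>] obtain t where t: "(\<Sum>v<p. v) = p * t" ..
  have pm: "p * m dvd m\<^sup>2"
    using assms(2) by (simp add: power2_eq_square)
  have inner: "[(\<Sum>v<p. (m * v + u) ^ k) = p * u ^ k] (mod p * m)" for u
  proof -
    have "[(\<Sum>v<p. (m * v + u) ^ k) = (\<Sum>v<p. u ^ k + k * u ^ (k - 1) * (m * v))] (mod p * m)"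
      by (intro cong_sum cong_dvd_modulus_nat [OF power_add_mult_cong_square pm])
    also have "(\<Sum>v<p. u ^ k + k * u ^ (k - 1) * (m * v)) = p * u ^ k + (k * u ^ (k - 1) * m) * (\<Sum>v<p. v)"
      by (simp add: sum.distrib sum_distrib_left mult.assoc)
    also have "\<dots> = p * u ^ k + (p * m) * (k * u ^ (k - 1) * t)"
      by (simp add: t)
    also have "[\<dots> = p * u ^ k] (mod p * m)"
      unfolding cong_def by (rule mod_mult_self2)
    finally show ?thesis .
  qed
  have "[(\<Sum>j<p * m. j ^ k) = (\<Sum>u<m. p * u ^ k)] (mod p * m)"
    unfolding sum_powers_mult by (intro cong_sum inner)
  hence "p * m dvd p * (\<Sum>u<m. u ^ k)"
    using assms(3) by (simp add: cong_dvd_iff sum_distrib_left)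
  thus ?thesis
    using \<open>odd p\<close> by (auto simp: odd_pos)
qed

text \<open>
  By Fermat's theorem every summand prime to \<open>p\<close> is \<open>1\<close> modulo \<open>p\<close>, so the sum is
  \<open>m * (p - 1)\<close>, that is \<open>- m\<close>, modulo \<open>p\<close>.
\<close>

lemma not_dvd_sum_powers_prime:
  fixes p k m :: nat
  assumes "prime p" "p - 1 dvd k" "k > 0" "\<not> p dvd m"
  shows "\<not> p dvd (\<Sum>j<m * p. j ^ k)"
proof
  assume *: "p dvd (\<Sum>j<m * p. j ^ k)"
  have p0: "p > 0" using assms(1) prime_gt_0_nat by blast
  have residue: "[(p * v + u) ^ k = (if u = 0 then 0 else 1)] (mod p)" if "u < p" for u v
  proof -
    have "[(p * v + u) ^ k = u ^ k] (mod p)"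
      by (intro cong_pow) (simp add: cong_def)
    also have "[u ^ k = (if u = 0 then 0 else 1)] (mod p)"
    proof (cases "u = 0")
      case False
      hence "\<not> p dvd u" using \<open>u < p\<close> by (auto dest: dvd_imp_le)
      hence "[u ^ (p - 1) = 1] (mod p)"
        using assms(1) fermat_theorem by blast
      moreover obtain t where "k = (p - 1) * t" using assms(2) ..
      ultimately show ?thesis
        using cong_pow [of "u ^ (p - 1)" 1 p t] False by (simp add: power_mult)
    qed (use \<open>k > 0\<close> in \<open>simp add: power_0_left\<close>)
    finally show ?thesis .
  qed
  have "[(\<Sum>j<m * p. j ^ k) = (\<Sum>u<p. \<Sum>v<m. if u = 0 then 0 else 1)] (mod p)"
    unfolding sum_powers_mult by (intro cong_sum residue) simp
  also have "(\<Sum>u<p. \<Sum>v<m. if u = 0 then 0 else 1::nat) = (\<Sum>u<p. if u = 0 then 0 else m)"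
    by (intro sum.cong) auto
  also have "\<dots> = (p - 1) * m"
    using p0 by (cases p) (simp_all add: sum.lessThan_Suc_shift del: sum.lessThan_Suc)
  finally have "p dvd (p - 1) * m"
    using * by (simp add: cong_dvd_iff)
  hence "p dvd p - 1" using assms by (simp add: prime_dvd_mult_iff)
  thus False using assms(1) prime_gt_1_nat [of p] by (auto dest: dvd_imp_le)
qed

text \<open>
  Write \<open>n = p ^ a * m\<close> with \<open>p\<close> not dividing \<open>m\<close>. Divisibility for the exponent \<open>a\<close> would descend to
  the exponent \<open>1\<close>, where it fails already modulo \<open>p\<close>.
\<close>

lemma not_dvd_power_sum:
  fixes n p k :: nat
  assumes "prime p" "odd p" "p dvd n" "n > 0" "p - 1 dvd k" "k > 0"
  shows "\<not> n dvd power_sum k n"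
proof
  assume "n dvd power_sum k n"
  \<comment> \<open>Passing from the range \<open>1..n\<close> to \<open>0..n - 1\<close> changes the sum by \<open>n ^ k\<close>, a multiple of \<open>n\<close>.\<close>
  moreover have "power_sum k n + 0 ^ k = (\<Sum>j<n. j ^ k) + n ^ k"
    unfolding power_sum_def
    by (metis add.commute atLeast0AtMost atLeast0LessThan lessThan_Suc_atMost
        sum.atLeast_Suc_atMost sum.lessThan_Suc One_nat_def zero_le)
  ultimately have "n dvd (\<Sum>j<n. j ^ k)"
    using \<open>k > 0\<close> dvd_power [of k n] by (simp add: power_0_left dvd_add_left_iff)
  moreover obtain m a where n: "n = p ^ a * m" "\<not> p dvd m" 
    using \<open>n > 0\<close> \<open>prime p\<close> by (metis multiplicity_decompose' not_gr0 not_prime_unit)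
  hence "a > 0" using \<open>p dvd n\<close> by (cases a) auto
  have "\<not> p ^ Suc b * m dvd (\<Sum>j<p ^ Suc b * m. j ^ k)" for b
  proof (induction b)
    case 0
    from not_dvd_sum_powers_prime [OF assms(1,5,6) n(2)] show ?case
      by (auto simp: ac_simps dest: dvd_mult_left)
  next
    case (Suc b)
    with sum_powers_descent [OF \<open>odd p\<close>, of "p ^ Suc b * m" k] show ?case
      by (auto simp: ac_simps)
  qed
  ultimately show False
    using n(1) \<open>a > 0\<close> by (metis Suc_pred)
qed

lemma prime_minus_one_dvd_Carmichael:
  assumes "prime p" "odd p" "p dvd n" "n > 0"
  shows "p - 1 dvd Carmichael n"
proof -
  obtain m a where n: "n = p ^ a * m" "\<not> p dvd m"
    using \<open>n > 0\<close> \<open>prime p\<close> by (metis multiplicity_decompose' not_gr0 not_prime_unit)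
  hence "a > 0" using \<open>p dvd n\<close> by (cases a) auto
  have "coprime (p ^ a) m"
    using n(2) assms(1) by (simp add: prime_imp_coprime)
  hence "Carmichael n = lcm (p ^ (a - 1) * (p - 1)) (Carmichael m)"
    using n(1) Carmichael_mult_coprime Carmichael_odd_prime_power assms(1,2) \<open>a > 0\<close> by metis
  thus ?thesis
    by (metis dvd_lcm1 dvd_mult_right)
qed

text \<open>
  The prime \<open>q\<close> contributes a factor \<open>4\<close> to \<open>Carmichael n\<close>, one factor \<open>2\<close> more than \<open>p - 1\<close> has;
  so \<open>p - 1\<close> still divides half of it.
\<close>

lemma M_half_Carmichael_residues:
  assumes "n \<in> M_half_Carmichael"
    and "prime p" "p dvd n" "p mod 4 = 3"
    and "prime q" "q dvd n" "q mod 4 = 1"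
  shows False
proof -
  define k where "k = Carmichael n div 2"
  have n: "n \<ge> 3" "n dvd power_sum k n"
    using assms(1) by (auto simp: M_half_Carmichael_def k_def)
  have odd: "odd p" "odd q" using assms(4,7) by presburger+
  define m where "m = p div 2"
  have p: "p - 1 = 2 * m" and "odd m" 
    using assms(4) unfolding m_def by presburger+
  have "4 dvd q - 1" using assms(7) by presburger
  hence "4 dvd Carmichael n"
    using prime_minus_one_dvd_Carmichael [of q n] assms odd n by (auto intro: dvd_trans)
  moreover have "m dvd Carmichael n"
    using prime_minus_one_dvd_Carmichael [of p n] assms odd n p by (auto dest: dvd_mult_right)
  moreover have "coprime (2 ^ 2) m"
    using \<open>odd m\<close> by (simp only: coprime_power_left_iff coprime_left_2_iff_odd) simp
  ultimately have "2 ^ 2 * m dvd Carmichael n"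
    by (intro divides_mult) simp_all
  hence "p - 1 dvd k"
    unfolding k_def p by auto
  moreover have "k > 0" unfolding k_def using n(1) by (rule half_Carmichael_pos)
  ultimately show False
    using not_dvd_power_sum [of p n k] assms odd n by simp
qed

section \<open>Densities of sifted sets\<close>

text \<open>
  The integers up to \<open>N\<close> that survive \<open>P\<close> but are removed by a further prime \<open>q\<close> are \<open>q\<close> times the
  survivors of \<open>P\<close> up to \<open>N div q\<close>. Adding \<open>q\<close> therefore multiplies the density by \<open>1 - 1 / q\<close> and
  turns an error bound \<open>c\<close> into \<open>2 * c + 1\<close>, the \<open>1\<close> coming from rounding \<open>N / q\<close>.
\<close>

lemma card_sieve:
  assumes "finite P" "\<And>p. p \<in> P \<Longrightarrow> prime p"
  shows "\<exists>c. \<forall>N. \<bar>real (card {n\<in>{1..N}. \<forall>p\<in>P. \<not> p dvd n}) - real N * (\<Prod>p\<in>P. 1 - 1 / real p)\<bar> \<le> c"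
  using assms
proof (induction P rule: finite_induct)
  case empty
  have "{n\<in>{1..N}. \<forall>p\<in>{}. \<not> p dvd n} = {1..N}" for N :: nat
    by auto
  thus ?case by (intro exI [of _ 0]) (simp del: atLeastAtMost_iff)
next
  case (insert q P)
  define C where "C N = card {n\<in>{1..N}. \<forall>p\<in>P. \<not> p dvd n}" for N :: nat
  define d where "d = (\<Prod>p\<in>P. 1 - 1 / real p)"
  from insert obtain c where c: "\<And>N. \<bar>real (C N) - real N * d\<bar> \<le> c"
    unfolding C_def d_def by auto
  have q: "prime q" "q > 0" using insert.prems by (auto simp: prime_gt_0_nat)
  have ndvd: "\<not> p dvd q" if "p \<in> P" for p
    using that insert q by (metis insertI2 primes_dvd_imp_eq)
  have d: "0 \<le> d" "d \<le> 1"
    using insert.prems unfolding d_def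
    by (auto intro!: prod_nonneg prod_le_1 simp: prime_gt_0_nat Suc_leI)
  have "\<bar>real (card {n\<in>{1..N}. \<forall>p\<in>insert q P. \<not> p dvd n}) - real N * (d * (1 - 1 / q))\<bar> \<le> 2 * c + 1" for N
  proof -
    have "{n\<in>{1..N}. \<forall>p\<in>P. \<not> p dvd n} = {n\<in>{1..N}. \<forall>p\<in>insert q P. \<not> p dvd n} \<union>
        (*) q ` {n\<in>{1..N div q}. \<forall>p\<in>P. \<not> p dvd n}" (is "?A = ?B \<union> ?C")
    proof (intro equalityI subsetI)
      fix n assume n: "n \<in> ?A"
      show "n \<in> ?B \<union> ?C"
      proof (cases "q dvd n")
        case True
        then obtain m where "n = q * m" ..
        with n q have "m \<in> {n\<in>{1..N div q}. \<forall>p\<in>P. \<not> p dvd n}"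
          by (auto simp: less_eq_div_iff_mult_less_eq ac_simps Suc_le_eq)
        thus ?thesis using \<open>n = q * m\<close> by blast
      qed (use n in auto)
    next
      fix n assume "n \<in> ?B \<union> ?C"
      thus "n \<in> ?A"
      proof
        assume "n \<in> ?C"
        then obtain m where m: "n = q * m" "m \<in> {1..N div q}" "\<forall>p\<in>P. \<not> p dvd m" by auto
        thus ?thesis using q ndvd insert.prems
          by (auto simp: less_eq_div_iff_mult_less_eq ac_simps Suc_le_eq prime_dvd_mult_iff)
      qed auto
    qed
    moreover have "card ?C = C (N div q)"
      unfolding C_def using q by (intro card_image) (auto simp: inj_on_def)
    moreover have "card (?B \<union> ?C) = card ?B + card ?C"
      by (rule card_Un_disjoint) auto
    ultimately have card_B: "real (card ?B) = real (C N) - real (C (N div q))"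
      unfolding C_def by simp
    have floor: "\<bar>real (N div q) * d - (real N / q) * d\<bar> \<le> 1"
    proof -
      have "real N = q * real (N div q) + real (N mod q)"
        by (metis mult_div_mod_eq of_nat_add of_nat_mult)
      hence "real N / q - real (N div q) = real (N mod q) / q"
        using q(2) by (simp add: field_simps)
      moreover have "real (N mod q) / q \<le> 1"
        using q(2) by (simp add: less_imp_le)
      ultimately have "real N / q - real (N div q) \<ge> 0" "real N / q - real (N div q) \<le> 1"
        by simp_all
      with d have "\<bar>(real N / q - real (N div q)) * d\<bar> \<le> 1"
        by (simp add: abs_mult mult_le_one)
      thus ?thesis by (simp add: algebra_simps abs_if split: if_splits)
    qed
    have main: "real N * (d * (1 - 1 / q)) = real N * d - real N / q * d"
      by (simp add: algebra_simps)
    have "\<bar>(a - b) - (x - z)\<bar> \<le> 2 * c + 1"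
      if "\<bar>a - x\<bar> \<le> c" "\<bar>b - y\<bar> \<le> c" "\<bar>y - z\<bar> \<le> 1" for a b x y z :: real
      using that by linarith
    from this [OF c c floor] show ?thesis unfolding card_B main .
  qed
  thus ?case
    using insert.hyps unfolding d_def by (auto simp: mult.commute)
qed

lemma has_asymptotic_density_sieve_0:
  assumes "\<And>p. p \<in> X \<Longrightarrow> prime p"
    and "\<And>e. e > 0 \<Longrightarrow> \<exists>P\<subseteq>X. finite P \<and> (\<Prod>p\<in>P. 1 - 1 / real p) < e"
  shows "has_asymptotic_density {n. \<forall>p\<in>X. \<not> p dvd n} 0"
  unfolding has_asymptotic_density_def
proof (rule LIMSEQ_I)
  fix e :: real assume "e > 0"
  then obtain P where P: "P \<subseteq> X" "finite P" "(\<Prod>p\<in>P. 1 - 1 / real p) < e / 2"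
    using assms(2) [of "e / 2"] by auto
  then obtain c where c: "\<And>N. \<bar>real (card {n\<in>{1..N}. \<forall>p\<in>P. \<not> p dvd n})
      - real N * (\<Prod>p\<in>P. 1 - 1 / real p)\<bar> \<le> c"
    using card_sieve [of P] assms(1) by blast
  obtain K :: nat where K: "real K > 2 * c / e" using reals_Archimedean2 by blast
  show "\<exists>no. \<forall>N\<ge>no. norm (real (card ({n. \<forall>p\<in>X. \<not> p dvd n} \<inter> {1..N})) / real N - 0) < e"
  proof (intro exI allI impI)
    fix N assume N: "N \<ge> Suc K"
    have "card ({n. \<forall>p\<in>X. \<not> p dvd n} \<inter> {1..N}) \<le> card {n\<in>{1..N}. \<forall>p\<in>P. \<not> p dvd n}"
      using P(1) by (intro card_mono) auto
    also have "real \<dots> \<le> real N * (\<Prod>p\<in>P. 1 - 1 / real p) + c"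
      using c [of N] by linarith
    also have "\<dots> < real N * (e / 2) + real N * (e / 2)"
    proof -
      have "c < real K * (e / 2)" using K \<open>e > 0\<close> by (simp add: field_simps)
      also have "\<dots> \<le> real N * (e / 2)" using N \<open>e > 0\<close> by (intro mult_right_mono) auto
      finally show ?thesis 
        using P(3) N by (intro add_strict_mono mult_strict_left_mono) auto
    qed
    finally show "norm (real (card ({n. \<forall>p\<in>X. \<not> p dvd n} \<inter> {1..N})) / real N - 0) < e"
      using N by (simp add: field_simps)
  qed
qed

section \<open>Euler products over the reals\<close>

text \<open>
  The same sieve for weighted sums, where it is exact: by multiplicativity, the terms of the sum over
  the survivors of \<open>P\<close> that belong to multiples of \<open>q\<close> add up to \<open>f q\<close> times the whole sum.
\<close>

lemma infsum_sieve:
  fixes f :: "nat \<Rightarrow> real"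
  assumes "finite P" "\<And>p. p \<in> P \<Longrightarrow> prime p"
    and mult: "\<And>m n. f (m * n) = f m * f n" and summable: "f summable_on UNIV"
  shows "infsum f {n. \<forall>p\<in>P. \<not> p dvd n} = infsum f UNIV * (\<Prod>p\<in>P. 1 - f p)"
  using assms(1,2)
proof (induction P rule: finite_induct)
  case (insert q P)
  let ?A = "{n. \<forall>p\<in>P. \<not> p dvd n}" and ?B = "{n. \<forall>p\<in>insert q P. \<not> p dvd n}"
  have q: "prime q" "q > 0" using insert.prems by (auto simp: prime_gt_0_nat)
  have ndvd: "\<not> p dvd q" if "p \<in> P" for p
    using that insert q by (metis insertI2 primes_dvd_imp_eq)
  have summ: "f summable_on S" for S
    using summable by (rule summable_on_subset_banach) auto
  have "?A = ?B \<union> (*) q ` ?A"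
  proof (intro equalityI subsetI)
    fix n assume n: "n \<in> ?A"
    show "n \<in> ?B \<union> (*) q ` ?A"
    proof (cases "q dvd n")
      case True
      then obtain m where "n = q * m" ..
      with n have "m \<in> ?A" by auto
      thus ?thesis using \<open>n = q * m\<close> by blast
    qed (use n in auto)
  qed (use ndvd insert.prems in \<open>auto simp: prime_dvd_mult_iff\<close>)
  moreover have "infsum f (?B \<union> (*) q ` ?A) = infsum f ?B + infsum f ((*) q ` ?A)"
    by (intro infsum_Un_disjoint summ) auto
  moreover have "infsum f ((*) q ` ?A) = f q * infsum f ?A"
    using q by (subst infsum_reindex) (auto simp: inj_on_def o_def mult infsum_cmult_right')
  ultimately have "infsum f ?B = infsum f ?A * (1 - f q)"
    by (simp add: algebra_simps)
  with insert show ?case by (simp add: ac_simps)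
qed simp

text \<open>
  For \<open>N \<ge> 2\<close>, sieving by all primes up to \<open>N\<close> leaves \<open>1\<close> and integers above \<open>N\<close>, and the latter
  contribute at most a tail of a convergent series.
\<close>

lemma euler_product_real:
  fixes f :: "nat \<Rightarrow> real"
  assumes mult: "\<And>m n. f (m * n) = f m * f n" and summable: "summable (\<lambda>n. \<bar>f n\<bar>)"
  shows "(\<lambda>N. (\<Sum>n. f n) * (\<Prod>p | prime p \<and> p \<le> N. 1 - f p)) \<longlonglongrightarrow> f 1"
proof -
  have hs: "(f has_sum (\<Sum>n. f n)) UNIV" "((\<lambda>n. \<bar>f n\<bar>) has_sum (\<Sum>n. \<bar>f n\<bar>)) UNIV"
    using norm_summable_imp_has_sum [OF _ summable_sums [OF summable_rabs_cancel [OF summable]]]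
      norm_summable_imp_has_sum [OF _ summable_sums [OF summable]] summable
    by simp_all
  have summ: "f summable_on S" "(\<lambda>n. \<bar>f n\<bar>) summable_on S" for S
    by (rule summable_on_subset_banach [OF has_sum_imp_summable, OF hs(1)] 
          summable_on_subset_banach [OF has_sum_imp_summable, OF hs(2)], simp)+
  let ?S = "\<lambda>N. {n. \<forall>p\<in>{p. prime p \<and> p \<le> N}. \<not> p dvd n}"
  have eq: "(\<Sum>n. f n) * (\<Prod>p | prime p \<and> p \<le> N. 1 - f p) = infsum f (?S N)" for N
    by (subst infsum_sieve) (use hs(1) in \<open>auto simp: mult summ infsumI\<close>)
  have bound: "\<bar>infsum f (?S N) - f 1\<bar> \<le> (\<Sum>n. \<bar>f n\<bar>) - (\<Sum>n\<le>N. \<bar>f n\<bar>)" if "N \<ge> 2" for N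
  proof -
    have one: "1 \<in> ?S N" by auto
    have sub: "?S N - {1} \<subseteq> - {..N}"
    proof
      fix n assume n: "n \<in> ?S N - {1}"
      hence "n \<noteq> 1" by simp
      then obtain p where p: "prime p" "p dvd n" using prime_factor_nat by blast
      have "\<not> 2 dvd n" using n that two_is_prime_nat by blast
      hence "n \<noteq> 0" by (metis dvd_0_right)
      hence "p \<le> n" using p by (simp add: dvd_imp_le)
      moreover have "\<not> p \<le> N" using p n by blast
      ultimately show "n \<in> - {..N}" by simp
    qed
    have "?S N = {1} \<union> (?S N - {1})" using one by blast
    hence "infsum f (?S N) = infsum f ({1} \<union> (?S N - {1}))" by (rule arg_cong)
    also have "\<dots> = f 1 + infsum f (?S N - {1})"
      by (subst infsum_Un_disjoint) (simp_all add: summ)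
    finally have "infsum f (?S N) = f 1 + infsum f (?S N - {1})" .
    hence "\<bar>infsum f (?S N) - f 1\<bar> = \<bar>infsum f (?S N - {1})\<bar>" by simp
    also have "\<dots> \<le> infsum (\<lambda>n. \<bar>f n\<bar>) (?S N - {1})"
      using norm_infsum_bound [of f "?S N - {1}"] summ by simp
    also have "\<dots> \<le> infsum (\<lambda>n. \<bar>f n\<bar>) (- {..N})"
      using sub by (intro infsum_mono2 summ) auto
    also have "\<dots> = infsum (\<lambda>n. \<bar>f n\<bar>) UNIV - (\<Sum>n\<le>N. \<bar>f n\<bar>)"
    proof -
      have "infsum (\<lambda>n. \<bar>f n\<bar>) ({..N} \<union> - {..N}) =
          infsum (\<lambda>n. \<bar>f n\<bar>) {..N} + infsum (\<lambda>n. \<bar>f n\<bar>) (- {..N})"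
        by (intro infsum_Un_disjoint summ) auto
      thus ?thesis by (simp del: Compl_atMost)
    qed
    finally show ?thesis using hs(2) by (simp add: infsumI)
  qed
  have "(\<lambda>N. (\<Sum>n. \<bar>f n\<bar>) - (\<Sum>n\<le>N. \<bar>f n\<bar>)) \<longlonglongrightarrow> (\<Sum>n. \<bar>f n\<bar>) - (\<Sum>n. \<bar>f n\<bar>)"
    by (intro tendsto_intros summable_LIMSEQ' summable)
  hence lim: "(\<lambda>N. (\<Sum>n. \<bar>f n\<bar>) - (\<Sum>n\<le>N. \<bar>f n\<bar>)) \<longlonglongrightarrow> 0" by simp
  have "(\<lambda>N. infsum f (?S N) - f 1) \<longlonglongrightarrow> 0"
    by (rule Lim_null_comparison [OF _ lim])
       (use bound in \<open>auto intro!: eventually_sequentiallyI [of 2]\<close>)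
  thus ?thesis unfolding eq by (simp add: LIM_zero_iff)
qed

section \<open>The zeta function and the character modulo 4 near 1\<close>

text \<open>
  The nontrivial Dirichlet character modulo \<open>4\<close>.
\<close>

definition chi4 :: "nat \<Rightarrow> real" where
  "chi4 n = (if n mod 4 = 1 then 1 else if n mod 4 = 3 then -1 else 0)"

lemma chi4_mult: "chi4 (m * n) = chi4 m * chi4 n"
proof -
  have "m mod 4 \<in> {0,1,2,3}" "n mod 4 \<in> {0,1,2,3}" by auto
  thus ?thesis
    unfolding chi4_def by (subst (1 2) mod_mult_eq [symmetric]) auto
qed

lemma abs_chi4_le_1: "\<bar>chi4 n\<bar> \<le> 1"
  by (simp add: chi4_def)

text \<open>
  The series is \<open>1 - 1 / 3 powr s + 1 / 5 powr s - ...\<close> with decreasing terms. Grouping consecutive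
  pairs from the first term on gives the lower bound \<open>1 - 1 / 3 powr s\<close>, and grouping them from the
  second term on gives the upper bound \<open>1\<close>.
\<close>

lemma L_chi4_bounds:
  fixes s :: real
  assumes "s > 1"
  shows "summable (\<lambda>n. \<bar>chi4 n * real n powr - s\<bar>)"
    and "2 / 3 \<le> (\<Sum>n. chi4 n * real n powr - s)"
    and "(\<Sum>n. chi4 n * real n powr - s) \<le> 1"
proof -
  let ?f = "\<lambda>n. chi4 n * real n powr - s"
  show abs: "summable (\<lambda>n. \<bar>?f n\<bar>)"
  proof (rule summable_comparison_test' [of "\<lambda>n. real n powr - s" 0])
    show "summable (\<lambda>n. real n powr - s)" using assms by (simp add: summable_real_powr_iff)
  qed (use abs_chi4_le_1 in \<open>auto simp: abs_mult intro!: mult_left_le_one_le\<close>)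
  hence sm: "summable ?f" by (rule summable_rabs_cancel)
  have mono: "real b powr - s \<le> real a powr - s" if "a \<le> b" "0 < a" for a b
    using that assms by (intro powr_mono2') auto
  have set4: "{n * 4..<n * 4 + 4} = {4 * n, 4 * n + 1, 4 * n + 2, 4 * n + 3}" for n :: nat
    by auto
  have chi: "chi4 (4 * n) = 0" "chi4 (4 * n + 1) = 1" "chi4 (4 * n + 2) = 0" 
      "chi4 (4 * n + 3) = -1" "chi4 (4 * n + 4) = 0" "chi4 (4 * n + 5) = 1" for n
    by (simp_all add: chi4_def mod_add_left_eq [symmetric], presburger+)
  have g1: "sum ?f {n * 4..<n * 4 + 4} = real (4 * n + 1) powr - s - real (4 * n + 3) powr - s" for n
    unfolding set4 by (simp add: chi [simplified])
  have "(\<lambda>n. sum ?f {n * 4..<n * 4 + 4}) sums suminf ?f"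
    by (rule sums_group [OF summable_sums [OF sm]]) simp
  hence group: "(\<lambda>n. real (4 * n + 1) powr - s - real (4 * n + 3) powr - s) sums suminf ?f"
    unfolding g1 .
  have "(\<Sum>n<1. real (4 * n + 1) powr - s - real (4 * n + 3) powr - s) \<le> suminf ?f"
    unfolding sums_unique [OF group] using mono
    by (intro sum_le_suminf sums_summable [OF group]) (simp_all del: of_nat_add of_nat_mult of_nat_Suc)
  moreover have "3 powr - s \<le> 3 powr - (1::real)" using assms by (intro powr_mono) auto
  ultimately show "2 / 3 \<le> suminf ?f" by (simp add: powr_minus)
  \<comment> \<open>Dropping the indices \<open>0\<close> and \<open>1\<close> makes each block of four start with a negative term.\<close>
  let ?g = "\<lambda>n. ?f (n + 2)"
  have set4': "{n * 4 + 2..<n * 4 + 4 + 2} = {4 * n + 2, 4 * n + 3, 4 * n + 4, 4 * n + 5}" for n :: nat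
    by auto
  have g2: "sum ?g {n * 4..<n * 4 + 4} = real (4 * n + 5) powr - s - real (4 * n + 3) powr - s" for n
    unfolding sum.shift_bounds_nat_ivl [of ?f, symmetric] set4' by (simp add: chi [simplified])
  have "(\<lambda>n. sum ?g {n * 4..<n * 4 + 4}) sums suminf ?g"
    by (rule sums_group [OF summable_sums]) (use sm summable_iff_shift [of ?f 2] in auto)
  hence "(\<lambda>n. real (4 * n + 5) powr - s - real (4 * n + 3) powr - s) sums suminf ?g"
    unfolding g2 .
  hence "suminf ?g \<le> 0"
    by (rule sums_le [OF _ _ sums_zero, rotated]) (simp add: mono del: of_nat_add of_nat_mult of_nat_Suc)
  moreover have "suminf ?f = suminf ?g + sum ?f {..<2}"
    using sm by (rule suminf_split_initial_segment)
  moreover have "sum ?f {..<2} = 1"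
    by (simp add: chi4_def numeral_2_eq_2)
  ultimately show "suminf ?f \<le> 1" by linarith
qed

text \<open>
  A bound valid for all \<open>s > 1\<close> would pass, in each partial sum, to the limit \<open>s = 1\<close> and bound the
  harmonic series.
\<close>

lemma zeta_unbounded_at_1:
  fixes K :: real
  shows "\<exists>s>1. (\<Sum>n. real n powr - s) > K"
proof (rule ccontr)
  assume "\<not> ?thesis"
  hence K: "(\<Sum>n. real n powr - s) \<le> K" if "s > 1" for s using that by force
  have "(\<Sum>n<M. real n powr - 1) \<le> K" for M
  proof -
    have "((\<lambda>s. \<Sum>n<M. real n powr - s) \<longlongrightarrow> (\<Sum>n<M. real n powr - 1)) (at_right 1)"
    proof (intro tendsto_sum)
      fix n
      show "((\<lambda>s. real n powr - s) \<longlongrightarrow> real n powr - 1) (at_right 1)"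
        by (cases "n = 0") (auto intro!: tendsto_powr tendsto_minus tendsto_const tendsto_ident_at simp del: powr_neg_one powr_neg_one')
    qed
    moreover have "\<forall>\<^sub>F s in at_right 1. (\<Sum>n<M. real n powr - s) \<le> K"
    proof (rule eventually_at_right_less [THEN eventually_mono])
      fix s :: real assume "1 < s"
      hence "(\<Sum>n<M. real n powr - s) \<le> (\<Sum>n. real n powr - s)"
        by (intro sum_le_suminf) (auto simp: summable_real_powr_iff)
      with K \<open>1 < s\<close> show "(\<Sum>n<M. real n powr - s) \<le> K" by force
    qed
    ultimately show ?thesis by (rule tendsto_upperbound) simp
  qed
  hence "summable (\<lambda>n. real n powr - 1)"
    by (intro summableI_nonneg_bounded [of _ K]) auto
  thus False by (simp add: summable_real_powr_iff del: powr_neg_one powr_neg_one')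
qed

section \<open>Primes in the two odd residue classes modulo 4\<close>

definition primes_mod_4 :: "nat \<Rightarrow> nat \<Rightarrow> nat set" where
  "primes_mod_4 r N = {p. prime p \<and> p \<le> N \<and> p mod 4 = r}"

lemma finite_primes_mod_4: "finite (primes_mod_4 r N)"
  by (rule finite_subset [of _ "{..N}"]) (auto simp: primes_mod_4_def)

lemma prod_primes_split:
  fixes f :: "nat \<Rightarrow> real"
  assumes "N \<ge> 2"
  shows "(\<Prod>p | prime p \<and> p \<le> N. f p) =
    f 2 * (\<Prod>p\<in>primes_mod_4 1 N. f p) * (\<Prod>p\<in>primes_mod_4 3 N. f p)"
proof -
  have "{p. prime p \<and> p \<le> N} = insert 2 (primes_mod_4 1 N \<union> primes_mod_4 3 N)"
  proof (intro equalityI subsetI)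
    fix p assume p: "p \<in> {p. prime p \<and> p \<le> N}"
    show "p \<in> insert 2 (primes_mod_4 1 N \<union> primes_mod_4 3 N)"
    proof (cases "p = 2")
      case False
      with p have "odd p" using prime_odd_nat [of p] prime_ge_2_nat [of p] by force
      hence "p mod 4 = 1 \<or> p mod 4 = 3" by presburger
      thus ?thesis using p by (auto simp: primes_mod_4_def)
    qed simp
  qed (use assms in \<open>auto simp: primes_mod_4_def\<close>)
  moreover have "2 \<notin> primes_mod_4 1 N \<union> primes_mod_4 3 N"
    by (auto simp: primes_mod_4_def)
  moreover have "primes_mod_4 1 N \<inter> primes_mod_4 3 N = {}"
    by (auto simp: primes_mod_4_def)
  ultimately show ?thesis
    by (simp add: finite_primes_mod_4 prod.union_disjoint mult.assoc)
qed

text \<open>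
  Enlarging \<open>S\<close> to an interval from \<open>2\<close> can only decrease the product, which then telescopes.
\<close>

lemma prod_one_minus_inverse_squares:
  fixes S :: "nat set"
  assumes "finite S" "S \<subseteq> {2..}"
  shows "1 / 2 \<le> (\<Prod>n\<in>S. 1 - 1 / (real n)\<^sup>2)"
proof -
  obtain N where N: "S \<subseteq> {..N}" using finite_nat_iff_bounded_le assms(1) by auto
  have le1: "0 \<le> 1 - 1 / (real n)\<^sup>2 \<and> 1 - 1 / (real n)\<^sup>2 \<le> 1" if "n \<ge> 2" for n :: nat
    using that by (auto simp: divide_le_eq_1)
  have telescope: "(\<Prod>n\<in>{2..Suc M}. 1 - 1 / (real n)\<^sup>2) = (real M + 2) / (2 * (real M + 1))" for M :: nat
  proof (induction M)
    case (Suc M)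
    have "{2..Suc (Suc M)} = insert (Suc (Suc M)) {2..Suc M}" by auto
    hence "(\<Prod>n\<in>{2..Suc (Suc M)}. 1 - 1 / (real n)\<^sup>2) =
        (1 - 1 / (real M + 2)\<^sup>2) * ((real M + 2) / (2 * (real M + 1)))"
      using Suc by (simp add: add.commute)
    also have "\<dots> = (real (Suc M) + 2) / (2 * (real (Suc M) + 1))"
    proof -
      have "(1 - 1 / y\<^sup>2) * (y / (2 * (y - 1))) = (y + 1) / (2 * y)" if "y > 1" for y :: real
        using that by (simp add: divide_simps) (simp add: algebra_simps power2_eq_square)
      from this [of "real M + 2"] show ?thesis by (simp add: add_ac)
    qed
    finally show ?case .
  qed simp
  have "1 / 2 \<le> (\<Prod>n\<in>{2..Suc N}. 1 - 1 / (real n)\<^sup>2)"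
    unfolding telescope by (simp add: field_simps)
  also have "\<dots> = (\<Prod>n\<in>{2..Suc N} - S. 1 - 1 / (real n)\<^sup>2) * (\<Prod>n\<in>S. 1 - 1 / (real n)\<^sup>2)"
    using assms N by (intro prod.subset_diff) force+
  also have "\<dots> \<le> 1 * (\<Prod>n\<in>S. 1 - 1 / (real n)\<^sup>2)"
    using le1 assms(2) by (intro mult_right_mono prod_nonneg prod_le_1) force+
  finally show ?thesis by simp
qed

text \<open>
  Suppose that the products for the class \<open>r\<close> are all at least \<open>e\<close>. For \<open>s > 1\<close> and \<open>x p = p powr - s\<close>,
  let \<open>a\<close> and \<open>b\<close> be the products of \<open>1 - x p\<close> over the primes up to \<open>N\<close> in the classes \<open>1\<close> and \<open>3\<close>, and
  \<open>c\<close> the product of \<open>1 + x p\<close> over the class \<open>3\<close>. The truncated inverse Euler products of \<open>Z = \<zeta>(s)\<close>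
  and \<open>L = L(s, \<chi>)\<close> are \<open>zN = (1 - x 2) * a * b\<close> and \<open>lN = a * c\<close>, and \<open>b * c\<close>, a product of factors
  \<open>1 - (x p)\<^sup>2\<close>, lies between \<open>1 / 2\<close> and \<open>1\<close>. If \<open>b\<close> is bounded below, the quotient \<open>zN / lN\<close>, whose limit
  is \<open>L / Z\<close>, is bounded below; if \<open>a\<close> is, then so is \<open>zN * lN\<close>, whose limit is \<open>1 / (Z * L)\<close>. Either
  way \<open>Z\<close> is at most \<open>6 / e\<^sup>2\<close> for every \<open>s > 1\<close>, which is impossible.
\<close>

lemma prod_primes_mod_4_small:
  fixes e :: real
  assumes r: "r = 1 \<or> r = 3" and "e > 0"
  shows "\<exists>N. (\<Prod>p\<in>primes_mod_4 r N. 1 - 1 / real p) < e"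
proof (rule ccontr)
  assume "\<not> ?thesis"
  hence e: "e \<le> (\<Prod>p\<in>primes_mod_4 r N. 1 - 1 / real p)" for N by (simp add: not_less)
  \<comment> \<open>The class \<open>3\<close> will give \<open>Z \<le> 2 / e\<^sup>2\<close>, and the class \<open>1\<close> gives \<open>Z * L \<le> 4 / e\<^sup>2\<close> with \<open>L \<ge> 2 / 3\<close>.\<close>
  obtain s where s: "s > 1" and large: "(\<Sum>n. real n powr - s) > 6 / e\<^sup>2"
    using zeta_unbounded_at_1 by blast
  define x where "x n = real n powr - s" for n :: nat
  define Z where "Z = (\<Sum>n. x n)"
  define L where "L = (\<Sum>n. chi4 n * x n)"
  define a where "a N = (\<Prod>p\<in>primes_mod_4 1 N. 1 - x p)" for N
  define b where "b N = (\<Prod>p\<in>primes_mod_4 3 N. 1 - x p)" for N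
  define c where "c N = (\<Prod>p\<in>primes_mod_4 3 N. 1 + x p)" for N
  have x_mult: "x (m * n) = x m * x n" for m n by (simp add: x_def powr_mult)
  have x1: "x 1 = 1" by (simp add: x_def)
  have x_pos: "0 \<le> x n" for n by (simp add: x_def)
  have x_le: "x n \<le> 1 / real n" if "n \<ge> 1" for n
  proof -
    have "x n \<le> real n powr - 1" unfolding x_def using that s by (intro powr_mono) auto
    thus ?thesis using that by (simp add: powr_minus_divide)
  qed
  have ge2: "2 \<le> p" if "p \<in> primes_mod_4 q N" for p q N
    using that by (simp add: primes_mod_4_def prime_ge_2_nat)
  have factor: "0 \<le> 1 - x p \<and> 1 - x p \<le> 1 \<and> 1 - 1 / real p \<le> 1 - x p \<and> 0 \<le> 1 - 1 / real p"
    if "p \<ge> 2" for p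
    using x_pos [of p] x_le [of p] that by (auto simp: order_trans [OF x_le])
  have a: "0 \<le> a N" and c: "0 \<le> c N" for N
    unfolding a_def c_def using factor ge2 x_pos
    by (auto intro!: prod_nonneg add_nonneg_nonneg)
  have Z: "Z > 6 / e\<^sup>2" using large by (simp add: Z_def x_def)
  hence "Z > 0" using \<open>e > 0\<close> by (smt (verit) divide_nonneg_nonneg zero_le_power2)
  have L: "2 / 3 \<le> L" "L \<le> 1"
    using L_chi4_bounds [OF s] by (simp_all add: L_def x_def)
  have bc: "b N * c N = (\<Prod>p\<in>primes_mod_4 3 N. 1 - (x p)\<^sup>2)" for N
    unfolding b_def c_def prod.distrib [symmetric]
    by (simp add: power2_eq_square algebra_simps)
  have bc_le: "b N * c N \<le> 1" for N
    unfolding bc using x_pos factor ge2 by (intro prod_le_1) (auto simp: power_le_one)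
  have bc_ge: "1 / 2 \<le> b N * c N" for N
  proof -
    have "1 / 2 \<le> (\<Prod>p\<in>primes_mod_4 3 N. 1 - 1 / (real p)\<^sup>2)"
      using ge2 by (intro prod_one_minus_inverse_squares finite_primes_mod_4) auto
    also have "\<dots> \<le> b N * c N"
      unfolding bc
    proof (intro prod_mono conjI)
      fix p assume "p \<in> primes_mod_4 3 N"
      hence p: "p \<ge> 2" by (rule ge2)
      show "0 \<le> 1 - 1 / (real p)\<^sup>2" using p by (simp add: divide_le_eq_1)
      have "(x p)\<^sup>2 \<le> (1 / real p)\<^sup>2" using p by (intro power_mono x_le x_pos) auto
      thus "1 - 1 / (real p)\<^sup>2 \<le> 1 - (x p)\<^sup>2" by (simp add: power_divide)
    qed
    finally show ?thesis .
  qed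
  define zN where "zN N = (\<Prod>p | prime p \<and> p \<le> N. 1 - x p)" for N
  define lN where "lN N = (\<Prod>p | prime p \<and> p \<le> N. 1 - chi4 p * x p)" for N
  have zN: "zN N = (1 - x 2) * a N * b N" if "N \<ge> 2" for N
    unfolding zN_def a_def b_def by (rule prod_primes_split [OF that])
  have lN: "lN N = a N * c N" if "N \<ge> 2" for N
  proof -
    have "(\<Prod>p\<in>primes_mod_4 1 N. 1 - chi4 p * x p) = a N"
      unfolding a_def by (intro prod.cong) (auto simp: primes_mod_4_def chi4_def)
    moreover have "(\<Prod>p\<in>primes_mod_4 3 N. 1 - chi4 p * x p) = c N"
      unfolding c_def by (intro prod.cong) (auto simp: primes_mod_4_def chi4_def)
    ultimately show ?thesis
      unfolding lN_def prod_primes_split [OF that] by (simp add: chi4_def)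
  qed
  have x2: "1 / 2 \<le> 1 - x 2" using x_le [of 2] by simp
  have limZ: "(\<lambda>N. Z * zN N) \<longlonglongrightarrow> 1"
  proof -
    have "(\<lambda>N. Z * zN N) \<longlonglongrightarrow> x 1"
      unfolding Z_def zN_def
    proof (rule euler_product_real)
      show "summable (\<lambda>n. \<bar>x n\<bar>)" using s by (simp add: x_def summable_real_powr_iff)
    qed (simp add: x_mult)
    thus ?thesis by (simp only: x1)
  qed
  have limL: "(\<lambda>N. L * lN N) \<longlonglongrightarrow> 1"
  proof -
    have "(\<lambda>N. L * lN N) \<longlonglongrightarrow> chi4 1 * x 1"
      unfolding L_def lN_def 
    proof (rule euler_product_real)
      show "summable (\<lambda>n. \<bar>chi4 n * x n\<bar>)" using L_chi4_bounds(1) [OF s] by (simp add: x_def)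
    qed (simp add: chi4_mult x_mult)
    thus ?thesis by (simp add: x1 [simplified] chi4_def)
  qed
  have "Z \<le> 6 / e\<^sup>2"
    using r
  proof
    assume "r = 3"
    have "e\<^sup>2 / 2 * lN N \<le> zN N" if "N \<ge> 2" for N
    proof -
      have "e \<le> b N"
        using e [of N] factor ge2 unfolding b_def \<open>r = 3\<close>
        by (meson order_trans prod_mono)
      hence "e * c N \<le> 1"
        using bc_le [of N] c [of N] by (meson mult_right_mono order_trans)
      hence "e * (e * c N) \<le> e * 1" using \<open>e > 0\<close> by (intro mult_left_mono) auto
      hence "e\<^sup>2 * c N \<le> b N" using \<open>e \<le> b N\<close> by (simp add: power2_eq_square mult.assoc)
      hence "1 / 2 * (a N * (e\<^sup>2 * c N)) \<le> (1 - x 2) * (a N * b N)"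
        using a [of N] c [of N] x2 by (intro mult_mono mult_left_mono mult_nonneg_nonneg) auto
      thus ?thesis using zN lN that by (simp add: mult_ac)
    qed
    hence "(e\<^sup>2 / 2 * Z) * (L * lN N) \<le> L * (Z * zN N)" if "N \<ge> 2" for N
      using mult_left_mono [of "e\<^sup>2 / 2 * lN N" "zN N" "L * Z"] that L \<open>Z > 0\<close>
      by (simp add: mult_ac)
    moreover have "(\<lambda>N. (e\<^sup>2 / 2 * Z) * (L * lN N)) \<longlonglongrightarrow> e\<^sup>2 / 2 * Z * 1"
      and "(\<lambda>N. L * (Z * zN N)) \<longlonglongrightarrow> L * 1"
      by (intro tendsto_intros limL limZ)+
    ultimately have "e\<^sup>2 / 2 * Z \<le> L" using LIMSEQ_le by fastforce
    hence "e\<^sup>2 * Z \<le> 6" using L by simp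
    thus ?thesis using \<open>e > 0\<close> by (simp add: field_simps)
  next
    assume "r = 1"
    have "e\<^sup>2 / 4 \<le> zN N * lN N" if "N \<ge> 2" for N
    proof -
      have "e \<le> a N"
        using e [of N] factor ge2 unfolding a_def \<open>r = 1\<close>
        by (meson order_trans prod_mono)
      hence "e\<^sup>2 \<le> (a N)\<^sup>2" using \<open>e > 0\<close> by (intro power_mono) auto
      hence "1 / 2 * (e\<^sup>2 * (1 / 2)) \<le> (1 - x 2) * ((a N)\<^sup>2 * (b N * c N))"
        using x2 bc_ge [of N] by (intro mult_mono mult_nonneg_nonneg) auto
      thus ?thesis using zN lN that by (simp add: power2_eq_square mult_ac)
    qed
    hence "Z * L * (e\<^sup>2 / 4) \<le> (Z * zN N) * (L * lN N)" if "N \<ge> 2" for N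
      using mult_left_mono [of "e\<^sup>2 / 4" "zN N * lN N" "Z * L"] that L \<open>Z > 0\<close>
      by (simp add: mult_ac)
    moreover have "(\<lambda>N. (Z * zN N) * (L * lN N)) \<longlonglongrightarrow> 1 * 1"
      by (intro tendsto_intros limL limZ)
    ultimately have "Z * L * (e\<^sup>2 / 4) \<le> 1" using LIMSEQ_le_const by fastforce
    moreover have "Z * (2 / 3) * (e\<^sup>2 / 4) \<le> Z * L * (e\<^sup>2 / 4)"
      using L \<open>Z > 0\<close> by (intro mult_right_mono mult_left_mono) auto
    ultimately have "Z * e\<^sup>2 \<le> 6" by simp
    thus ?thesis using \<open>e > 0\<close> by (simp add: field_simps)
  qed
  with Z show False by simp
qed

lemma has_asymptotic_density_no_prime_factor_mod_4:
  assumes "r = 1 \<or> r = 3"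
  shows "has_asymptotic_density {n. \<forall>p. prime p \<and> p mod 4 = r \<longrightarrow> \<not> p dvd n} 0"
proof -
  have "has_asymptotic_density {n. \<forall>p\<in>{p. prime p \<and> p mod 4 = r}. \<not> p dvd n} 0"
  proof (rule has_asymptotic_density_sieve_0)
    fix e :: real assume "e > 0"
    then obtain N where "(\<Prod>p\<in>primes_mod_4 r N. 1 - 1 / real p) < e"
      using prod_primes_mod_4_small assms by blast
    thus "\<exists>P\<subseteq>{p. prime p \<and> p mod 4 = r}. finite P \<and> (\<Prod>p\<in>P. 1 - 1 / real p) < e"
      by (intro exI [of _ "primes_mod_4 r N"]) (auto simp: finite_primes_mod_4, auto simp: primes_mod_4_def)
  qed simp
  thus ?thesis by simp
qed

lemma has_asymptotic_density_0_Un_subset: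
  assumes "has_asymptotic_density A 0" "has_asymptotic_density B 0" "M \<subseteq> A \<union> B"
  shows "has_asymptotic_density M 0"
  unfolding has_asymptotic_density_def
proof (rule tendsto_sandwich [OF _ _ tendsto_const])
  let ?d = "\<lambda>S N. real (card (S \<inter> {1..N})) / real N"
  show "(\<lambda>N. ?d A N + ?d B N) \<longlonglongrightarrow> 0"
    using tendsto_add [OF assms(1,2) [unfolded has_asymptotic_density_def]] by simp
  have "card (M \<inter> {1..N}) \<le> card (A \<inter> {1..N}) + card (B \<inter> {1..N})" for N
  proof -
    have "card (M \<inter> {1..N}) \<le> card ((A \<inter> {1..N}) \<union> (B \<inter> {1..N}))"
      using assms(3) by (intro card_mono) auto
    also have "\<dots> \<le> card (A \<inter> {1..N}) + card (B \<inter> {1..N})"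
      by (rule card_Un_le)
    finally show ?thesis .
  qed
  hence "?d M N \<le> ?d A N + ?d B N" for N
    unfolding add_divide_distrib [symmetric]
    by (intro divide_right_mono) (simp_all flip: of_nat_add)
  thus "\<forall>\<^sub>F N in sequentially. ?d M N \<le> ?d A N + ?d B N" by simp
qed simp

theorem proposition13:
  shows "has_asymptotic_density M_half_Carmichael 0"
proof (rule has_asymptotic_density_0_Un_subset)
  show "M_half_Carmichael \<subseteq> {n. \<forall>p. prime p \<and> p mod 4 = 3 \<longrightarrow> \<not> p dvd n}
      \<union> {n. \<forall>p. prime p \<and> p mod 4 = 1 \<longrightarrow> \<not> p dvd n}"
    using M_half_Carmichael_residues by blast
qed (intro has_asymptotic_density_no_prime_factor_mod_4, simp)+

end
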